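(* Let $\epsilon$ be a constant in $(0,1)$. There is a randomized algorithm, based on uniform random sampling, such that for every list of numbers $a_1,a_2,\ldots,a_n$ in $[0,1]$, with probability at least $3/4$ the algorithm outputs a $(1+\epsilon)$-approximation for the sum of the list, i.e. a real number $s$ with $$\frac{\sum_{i=1}^n a_i}{1+\epsilon}\le s\le (1+\epsilon)\sum_{i=1}^n a_i ,$$ and does so in time $O\!\left(\frac{n\log\log n}{\sum_{i=1}^n a_i}\right)$, where the constant in $O(\cdot)$ depends only on $\epsilon$.
   Context: The algorithm is given $n$ and has access to the list $L=(a_1,\ldots,a_n)$: in unit time it can draw an index uniformly at random from $\{1,\ldots,n\}$ (independently of earlier draws) and read the corresponding item, and it can also read the item at a chosen position in unit time. Elementary operations on numbers take unit time. The algorithm does not know $\sum_{i=1}^n a_i$ in advance. Logarithms are base 2, and the time bound is asymptotic, i.e. for all sufficiently large $n$. If $\sum_{i=1}^n a_i=0$, the time bound is read as $+\infty$ (no constraint on the time). *)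

theory Defs
  imports "HOL-Probability.Probability"
begin

text \<open>
  The machine model is a unit-cost real RAM. Memory cells are addressed by natural numbers and
  hold arbitrary real numbers. The only constants a program may contain are rational, so that a
  program is a finite object and cannot carry information in the digits of a real constant.
  There is no rounding operation: the operations on numbers are the four arithmetic operations and
  comparison. The only source of randomness is \<open>Draw\<close>.
\<close>

datatype instr =
    Const nat rat
  | Copy nat nat
  | Add nat nat nat
  | Sub nat nat nat
  | Mul nat nat nat
  | Div nat nat nat
  | Load nat nat
  | Store nat nat
  | Draw nat nat
  | Read nat nat
  | Jump nat
  | JumpLess nat nat nat
  | Halt

type_synonym prog = "instr list"

text \<open>The field \<open>used\<close> counts the entries of the random tape consumed so far.\<close>

record config =
  pc :: nat
  mem :: "nat \<Rightarrow> real"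
  used :: nat

definition set_mem :: "nat \<Rightarrow> real \<Rightarrow> config \<Rightarrow> config" where
  "set_mem d v c = c\<lparr>pc := Suc (pc c), mem := (mem c)(d := v)\<rparr>"

text \<open>
  Positions in the list \<open>L\<close> are numbered from 1. An instruction whose operands are illegal
  (division by zero, an address that is not a natural number, a position outside the list)
  leaves the configuration unchanged; such a computation never halts.
\<close>

fun exec :: "real list \<Rightarrow> (nat \<Rightarrow> nat) \<Rightarrow> instr \<Rightarrow> config \<Rightarrow> config" where
  "exec L \<omega> (Const d q) c = set_mem d (of_rat q) c"
| "exec L \<omega> (Copy d x) c = set_mem d (mem c x) c"
| "exec L \<omega> (Add d x y) c = set_mem d (mem c x + mem c y) c"
| "exec L \<omega> (Sub d x y) c = set_mem d (mem c x - mem c y) c"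
| "exec L \<omega> (Mul d x y) c = set_mem d (mem c x * mem c y) c"
| "exec L \<omega> (Div d x y) c = (if mem c y = 0 then c else set_mem d (mem c x / mem c y) c)"
| "exec L \<omega> (Load d p) c =
     (if mem c p \<in> \<nat> then set_mem d (mem c (nat \<lfloor>mem c p\<rfloor>)) c else c)"
| "exec L \<omega> (Store p x) c =
     (if mem c p \<in> \<nat> then set_mem (nat \<lfloor>mem c p\<rfloor>) (mem c x) c else c)"
| "exec L \<omega> (Draw p x) c =
     (let i = \<omega> (used c) in
      c\<lparr>pc := Suc (pc c), mem := (mem c)(p := real i, x := L ! (i - 1)), used := Suc (used c)\<rparr>)"
| "exec L \<omega> (Read d p) c =
     (if mem c p \<in> real ` {1..length L} then set_mem d (L ! (nat \<lfloor>mem c p\<rfloor> - 1)) c else c)"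
| "exec L \<omega> (Jump t) c = c\<lparr>pc := t\<rparr>"
| "exec L \<omega> (JumpLess x y t) c = c\<lparr>pc := (if mem c x < mem c y then t else Suc (pc c))\<rparr>"
| "exec L \<omega> Halt c = c"

definition step :: "prog \<Rightarrow> real list \<Rightarrow> (nat \<Rightarrow> nat) \<Rightarrow> config \<Rightarrow> config" where
  "step P L \<omega> c = (if pc c < length P then exec L \<omega> (P ! pc c) c else c)"

text \<open>The program is given the length of the list in cell 0 and leaves its output there.\<close>

definition init :: "real list \<Rightarrow> config" where
  "init L = \<lparr>pc = 0, mem = (\<lambda>_. 0)(0 := real (length L)), used = 0\<rparr>"

definition run :: "prog \<Rightarrow> real list \<Rightarrow> (nat \<Rightarrow> nat) \<Rightarrow> nat \<Rightarrow> config" where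
  "run P L \<omega> t = (step P L \<omega> ^^ t) (init L)"

definition halted :: "prog \<Rightarrow> config \<Rightarrow> bool" where
  "halted P c \<longleftrightarrow> pc c < length P \<and> P ! pc c = Halt"

definition halts :: "prog \<Rightarrow> real list \<Rightarrow> (nat \<Rightarrow> nat) \<Rightarrow> bool" where
  "halts P L \<omega> \<longleftrightarrow> (\<exists>t. halted P (run P L \<omega> t))"

text \<open>\<open>run_time\<close> and \<open>result\<close> are meaningful only if \<open>halts\<close> holds.\<close>

definition run_time :: "prog \<Rightarrow> real list \<Rightarrow> (nat \<Rightarrow> nat) \<Rightarrow> nat" where
  "run_time P L \<omega> = (LEAST t. halted P (run P L \<omega> t))"

definition result :: "prog \<Rightarrow> real list \<Rightarrow> (nat \<Rightarrow> nat) \<Rightarrow> real" where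
  "result P L \<omega> = mem (run P L \<omega> (run_time P L \<omega>)) 0"

text \<open>Random tapes for \<open>n > 0\<close>: independent uniform draws from \<open>{1..n}\<close>.\<close>

definition draws :: "nat \<Rightarrow> (nat \<Rightarrow> nat) measure" where
  "draws n = (\<Pi>\<^sub>M k\<in>UNIV. measure_pmf (pmf_of_set {1..n}))"

definition approximates :: "real \<Rightarrow> real \<Rightarrow> real \<Rightarrow> bool" where
  "approximates \<epsilon> S s \<longleftrightarrow> S / (1 + \<epsilon>) \<le> s \<and> s \<le> (1 + \<epsilon>) * S"

end

theory Submission
  imports Defs
begin

text \<open>
  Draw items until their running total reaches a constant \<open>K \<ge> 64 / \<epsilon>\<^sup>2\<close>. If this takes \<open>m \<le> n\<close> draws,
  output \<open>n * K / m\<close>; if \<open>n\<close> draws do not suffice, read the whole list and sum it exactly. With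
  \<open>\<mu>\<close> the mean of the list, a sample has variance at most \<open>\<mu>\<close>, so Chebyshev's inequality at the
  two fixed times \<open>K / ((1 + \<epsilon>) * \<mu>)\<close> and \<open>(1 + \<epsilon>) * K / \<mu>\<close> shows that the total is below \<open>K\<close> at
  the first and at least \<open>K\<close> at the second, each except with probability \<open>1/8\<close>. By monotonicity
  of the total, the stopping time lies between them, which is exactly the required accuracy.
  Falling back on the exact sum then means that \<open>n\<close> is at most the second time. Either way the
  running time is even \<open>O(n / S)\<close> for the sum \<open>S\<close>.
\<close>

subsection \<open>Concentration of sample sums\<close>

text \<open>Expanding the square gives a double sum: the covariances off the diagonal vanish by
  pairwise independence, and the diagonal leaves the variances. Integrability of the square is
  recorded too, because Chebyshev's inequality asks for it.\<close>

lemma (in prob_space) variance_sum_indep: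
  fixes X :: "'i \<Rightarrow> 'a \<Rightarrow> real"
  assumes "finite I" and indep: "indep_vars (\<lambda>_. borel) X I"
    and int: "\<And>i. i \<in> I \<Longrightarrow> integrable M (X i)"
    and int2: "\<And>i. i \<in> I \<Longrightarrow> integrable M (\<lambda>\<omega>. (X i \<omega>)\<^sup>2)"
  shows "variance (\<lambda>\<omega>. \<Sum>i\<in>I. X i \<omega>) = (\<Sum>i\<in>I. variance (X i))"
    and "integrable M (\<lambda>\<omega>. (\<Sum>i\<in>I. X i \<omega>)\<^sup>2)"
proof -
  have prod: "integrable M (\<lambda>\<omega>. X i \<omega> * X j \<omega>)"
    "i \<noteq> j \<Longrightarrow> expectation (\<lambda>\<omega>. X i \<omega> * X j \<omega>) = expectation (X i) * expectation (X j)"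
    if "i \<in> I" "j \<in> I" for i j
  proof -
    have "integrable M (\<lambda>\<omega>. X i \<omega> * X j \<omega>) \<and>
      expectation (\<lambda>\<omega>. X i \<omega> * X j \<omega>) = expectation (X i) * expectation (X j)" if "i \<noteq> j"
    proof -
      have "indep_vars (\<lambda>_. borel) X {i, j}"
        using indep by (rule indep_vars_subset) (use \<open>i \<in> I\<close> \<open>j \<in> I\<close> in auto)
      moreover have "\<And>k. k \<in> {i, j} \<Longrightarrow> integrable M (X k)"
        using int \<open>i \<in> I\<close> \<open>j \<in> I\<close> by auto
      ultimately have "integrable M (\<lambda>\<omega>. \<Prod>k\<in>{i, j}. X k \<omega>)"
        "expectation (\<lambda>\<omega>. \<Prod>k\<in>{i, j}. X k \<omega>) = (\<Prod>k\<in>{i, j}. expectation (X k))"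
        by (intro indep_vars_integrable indep_vars_lebesgue_integral; simp)+
      then show ?thesis using that by simp
    qed
    moreover have "integrable M (\<lambda>\<omega>. X i \<omega> * X i \<omega>)"
      using int2[OF \<open>i \<in> I\<close>] by (simp add: power2_eq_square)
    ultimately show "integrable M (\<lambda>\<omega>. X i \<omega> * X j \<omega>)"
      "i \<noteq> j \<Longrightarrow> expectation (\<lambda>\<omega>. X i \<omega> * X j \<omega>) = expectation (X i) * expectation (X j)"
      by (cases "i = j"; simp)+
  qed
  have square: "(\<lambda>\<omega>. (\<Sum>i\<in>I. X i \<omega>)\<^sup>2) = (\<lambda>\<omega>. \<Sum>i\<in>I. \<Sum>j\<in>I. X i \<omega> * X j \<omega>)"
    by (simp add: power2_eq_square sum_product)
  show int_square: "integrable M (\<lambda>\<omega>. (\<Sum>i\<in>I. X i \<omega>)\<^sup>2)"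
    unfolding square using prod(1) by (intro Bochner_Integration.integrable_sum) auto
  have "variance (\<lambda>\<omega>. \<Sum>i\<in>I. X i \<omega>)
      = (\<Sum>i\<in>I. \<Sum>j\<in>I. expectation (\<lambda>\<omega>. X i \<omega> * X j \<omega>)) - (\<Sum>i\<in>I. expectation (X i))\<^sup>2"
    using int int_square prod(1) unfolding square
    by (subst variance_eq) (auto simp: square Bochner_Integration.integral_sum)
  also have "\<dots> = (\<Sum>i\<in>I. \<Sum>j\<in>I. expectation (\<lambda>\<omega>. X i \<omega> * X j \<omega>) - expectation (X i) * expectation (X j))"
    by (simp add: power2_eq_square sum_product sum_subtractf)
  also have "\<dots> = (\<Sum>i\<in>I. \<Sum>j\<in>I. if j = i then variance (X i) else 0)"
    using prod(2) variance_eq[OF int int2]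
    by (intro sum.cong refl) (auto simp: power2_eq_square[of "expectation _"] power2_eq_square[of "X _ _"])
  also have "\<dots> = (\<Sum>i\<in>I. variance (X i))"
    using \<open>finite I\<close> by simp
  finally show "variance (\<lambda>\<omega>. \<Sum>i\<in>I. X i \<omega>) = (\<Sum>i\<in>I. variance (X i))" .
qed

section \<open>The random tape as a sequence of independent uniform draws\<close>

lemma prob_space_draws: "prob_space (draws n)"
  unfolding draws_def by (intro prob_space_PiM measure_pmf.prob_space_axioms)

lemma space_draws [simp]: "space (draws n) = UNIV"
  by (simp add: draws_def space_PiM)

lemma measurable_draws_component [measurable]: "(\<lambda>\<omega>. \<omega> k) \<in> draws n \<rightarrow>\<^sub>M count_space UNIV"
proof -
  have "(\<lambda>\<omega>. \<omega> k) \<in> draws n \<rightarrow>\<^sub>M measure_pmf (pmf_of_set {1..n})"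
    unfolding draws_def by (rule measurable_component_singleton) simp
  then show ?thesis
    by (simp cong: measurable_cong_sets)
qed

lemma distr_draws_component:
  "distr (draws n) (measure_pmf (pmf_of_set {1..n})) (\<lambda>\<omega>. \<omega> k) = measure_pmf (pmf_of_set {1..n})"
  unfolding draws_def by (rule distr_PiM_component) (auto intro: measure_pmf.prob_space_axioms)

text \<open>Independence means that the joint law is the product of the marginals. The map to all
  coordinates is the identity, so its law is \<open>draws n\<close>, a product by
  definition.\<close>

lemma indep_vars_draws:
  "prob_space.indep_vars (draws n) (\<lambda>_. borel) (\<lambda>k \<omega>. f (\<omega> k) :: real) I"
proof -
  interpret prob_space "draws n" by (rule prob_space_draws)
  let ?M = "measure_pmf (pmf_of_set {1..n})"
  have "indep_vars (\<lambda>_. ?M) (\<lambda>k \<omega>. \<omega> k) UNIV"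
  proof (subst indep_vars_iff_distr_eq_PiM)
    have "distr (draws n) (\<Pi>\<^sub>M k\<in>UNIV. ?M) (\<lambda>\<omega>. \<omega>) = draws n"
      unfolding draws_def by (rule distr_id)
    then show "distr (draws n) (\<Pi>\<^sub>M k\<in>UNIV. ?M) (\<lambda>\<omega>. \<lambda>k\<in>UNIV. \<omega> k)
        = (\<Pi>\<^sub>M k\<in>UNIV. distr (draws n) ?M (\<lambda>\<omega>. \<omega> k))"
      by (simp only: distr_draws_component restrict_UNIV) (simp add: draws_def)
  qed (auto cong: measurable_cong_sets)
  then have "indep_vars (\<lambda>_. ?M) (\<lambda>k \<omega>. \<omega> k) I"
    by (rule indep_vars_subset) simp
  then show ?thesis
    by (rule indep_vars_compose2) simp
qed

lemma expectation_draws: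
  fixes f :: "nat \<Rightarrow> real"
  assumes "n > 0"
  shows "integrable (draws n) (\<lambda>\<omega>. f (\<omega> k))"
    and "(\<integral>\<omega>. f (\<omega> k) \<partial>draws n) = (\<Sum>i=1..n. f i) / n"
proof -
  let ?M = "measure_pmf (pmf_of_set {1..n})"
  have ms: "(\<lambda>\<omega>. \<omega> k) \<in> draws n \<rightarrow>\<^sub>M ?M"
    by (simp cong: measurable_cong_sets)
  have "integrable ?M f"
    using assms by (intro integrable_measure_pmf_finite) (simp add: set_pmf_of_set)
  then show "integrable (draws n) (\<lambda>\<omega>. f (\<omega> k))"
    using integrable_distr[OF ms, of f] by (simp only: distr_draws_component)
  have "(\<integral>\<omega>. f (\<omega> k) \<partial>draws n) = (\<integral>i. f i \<partial>?M)"
    using integral_distr[OF ms, of f] by (simp only: distr_draws_component) simp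
  then show "(\<integral>\<omega>. f (\<omega> k) \<partial>draws n) = (\<Sum>i=1..n. f i) / n"
    using assms by (simp add: integral_pmf_of_set)
qed

text \<open>Indexed exactly as in \<open>Draw\<close>, so that it describes the running total of the
  program on every tape, even one with entries outside the list.\<close>

definition sample_sum :: "real list \<Rightarrow> (nat \<Rightarrow> nat) \<Rightarrow> nat \<Rightarrow> real" where
  "sample_sum L \<omega> m = (\<Sum>k<m. L ! (\<omega> k - 1))"

text \<open>For x in [0,1] the square is at most x, so one draw has variance at most \<mu>. Keeping
  this factor in the bound is what makes about \<open>K / \<mu>\<close> draws sufficient.\<close>

lemma sample_sum_deviation:
  assumes "L \<noteq> []" "set L \<subseteq> {0..1}" "d > 0"
  defines "\<mu> \<equiv> sum_list L / length L"
  shows "\<P>(\<omega> in draws (length L). d \<le> \<bar>sample_sum L \<omega> m - m * \<mu>\<bar>) \<le> m * \<mu> / d\<^sup>2"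
proof -
  define n where "n = length L"
  have n: "n > 0" using assms by (simp add: n_def)
  interpret prob_space "draws n" by (rule prob_space_draws)
  \<comment> \<open>Positions on the tape start at 1, list indices at 0; the shift turns averages
    over positions into sums over the list.\<close>
  have sum_nth: "(\<Sum>i=1..n. g (L ! (i - 1))) = (\<Sum>x\<leftarrow>L. g x)" for g :: "real \<Rightarrow> real"
    unfolding n_def sum_list_sum_nth
    by (rule sum.reindex_bij_witness[of _ Suc "\<lambda>i. i - 1"]) auto
  let ?X = "\<lambda>k \<omega>. L ! (\<omega> k - 1)"
  have E: "expectation (?X k) = \<mu>" for k
    using expectation_draws(2)[OF n, of "\<lambda>i. L ! (i - 1)"] sum_nth[of "\<lambda>x. x"]
    by (simp add: \<mu>_def n_def)
  have int: "integrable (draws n) (?X k)" "integrable (draws n) (\<lambda>\<omega>. (?X k \<omega>)\<^sup>2)" for k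
    using expectation_draws(1)[OF n, of "\<lambda>i. L ! (i - 1)"]
      expectation_draws(1)[OF n, of "\<lambda>i. (L ! (i - 1))\<^sup>2"] by simp_all
  have V: "variance (?X k) \<le> \<mu>" for k
  proof -
    have "variance (?X k) \<le> expectation (\<lambda>\<omega>. (?X k \<omega>)\<^sup>2)"
      using int by (simp add: variance_eq)
    also have "\<dots> = (\<Sum>x\<leftarrow>L. x\<^sup>2) / n"
      using expectation_draws(2)[OF n, of "\<lambda>i. (L ! (i - 1))\<^sup>2"] sum_nth[of "\<lambda>x. x\<^sup>2"] by simp
    also have "(\<Sum>x\<leftarrow>L. x\<^sup>2) \<le> (\<Sum>x\<leftarrow>L. x)"
      using assms(2) by (intro sum_list_mono) (auto simp: power2_eq_square mult_left_le)
    finally show ?thesis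
      using n by (simp add: \<mu>_def n_def divide_right_mono)
  qed
  have vs: "variance (\<lambda>\<omega>. \<Sum>k<m. ?X k \<omega>) = (\<Sum>k<m. variance (?X k))"
    "integrable (draws n) (\<lambda>\<omega>. (\<Sum>k<m. ?X k \<omega>)\<^sup>2)"
    by (intro variance_sum_indep indep_vars_draws int; simp)+
  have "prob {\<omega> \<in> space (draws n). d \<le> \<bar>(\<Sum>k<m. ?X k \<omega>) - expectation (\<lambda>\<omega>. \<Sum>k<m. ?X k \<omega>)\<bar>}
      \<le> variance (\<lambda>\<omega>. \<Sum>k<m. ?X k \<omega>) / d\<^sup>2"
    using vs(2) \<open>d > 0\<close> int by (intro Chebyshev_inequality) auto
  also have "variance (\<lambda>\<omega>. \<Sum>k<m. ?X k \<omega>) / d\<^sup>2 \<le> m * \<mu> / d\<^sup>2"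
    unfolding vs(1) using sum_bounded_above[of "{..<m}" "\<lambda>k. variance (?X k)"] V
    by (intro divide_right_mono) simp_all
  also have "expectation (\<lambda>\<omega>. \<Sum>k<m. ?X k \<omega>) = m * \<mu>"
    by (subst Bochner_Integration.integral_sum) (use int E in auto)
  finally show ?thesis
    unfolding sample_sum_def n_def .
qed

text \<open>The sample space contains all functions, so illegal tapes exist but form a null set. Off
  it every drawn item is an entry of the list, which monotonicity of the totals relies on.\<close>

lemma AE_draws:
  assumes "n > 0"
  shows "AE \<omega> in draws n. \<forall>k. \<omega> k \<in> {1..n}"
proof -
  have "AE \<omega> in draws n. \<omega> k \<in> {1..n}" for k
    unfolding draws_def using assms
    by (intro AE_PiM_component measure_pmf.prob_space_axioms) (auto simp: AE_measure_pmf_iff set_pmf_of_set)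
  then show ?thesis by (subst AE_all_countable) blast
qed

text \<open>At both times the expected total is at most \<open>2 * K\<close> and differs from
  \<open>K\<close> by at least \<open>K * \<epsilon> / 2\<close>. One deviation estimate therefore
  serves both, and the union bound leaves 3/4.\<close>

lemma sample_sum_concentration:
  assumes "L \<noteq> []" "set L \<subseteq> {0..1}" "0 < sum_list L" "0 < \<epsilon>" "\<epsilon> < 1" "64 / \<epsilon>\<^sup>2 \<le> K"
  defines "\<mu> \<equiv> sum_list L / length L"
  shows "\<P>(\<omega> in draws (length L). sample_sum L \<omega> (nat \<lfloor>K / ((1 + \<epsilon>) * \<mu>)\<rfloor>) < K \<and>
      K \<le> sample_sum L \<omega> (nat \<lfloor>(1 + \<epsilon>) * K / \<mu>\<rfloor>)) \<ge> 3 / 4"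
proof -
  interpret prob_space "draws (length L)" by (rule prob_space_draws)
  define a where "a = nat \<lfloor>K / ((1 + \<epsilon>) * \<mu>)\<rfloor>"
  define b where "b = nat \<lfloor>(1 + \<epsilon>) * K / \<mu>\<rfloor>"
  have \<mu>: "0 < \<mu>" "\<mu> \<le> 1"
  proof -
    show "0 < \<mu>" using assms by (simp add: \<mu>_def)
    have "sum_list L \<le> (\<Sum>x\<leftarrow>L. 1)" using assms(2) sum_list_mono[of L "\<lambda>x. x" "\<lambda>_. 1"] by (auto simp: subset_iff)
    then show "\<mu> \<le> 1" using assms(1) by (simp add: \<mu>_def sum_list_triv)
  qed
  note eps = assms(4,5)
  have Ke2: "64 \<le> K * \<epsilon>\<^sup>2" using assms(6) eps by (simp add: field_simps)
  have Ke: "64 \<le> K * \<epsilon>"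
  proof -
    have "0 < 64 / \<epsilon>\<^sup>2" using eps by simp
    then have "0 < K" using assms(6) by linarith
    moreover have "\<epsilon>\<^sup>2 \<le> \<epsilon>" using eps by (simp add: power2_eq_square mult_left_le)
    ultimately have "K * \<epsilon>\<^sup>2 \<le> K * \<epsilon>" by simp
    then show ?thesis using Ke2 by simp
  qed
  have K: "64 \<le> K"
  proof -
    have "0 < K" using Ke eps by (smt (verit) zero_less_mult_pos2)
    then have "K * \<epsilon> \<le> K" using eps by (simp add: mult_left_le)
    then show ?thesis using Ke by simp
  qed
  have a: "real a * \<mu> \<le> K / (1 + \<epsilon>)"
  proof -
    have "0 \<le> K / ((1 + \<epsilon>) * \<mu>)" using \<mu>(1) K eps by (intro divide_nonneg_pos) auto
    then have "real a \<le> K / ((1 + \<epsilon>) * \<mu>)" unfolding a_def by linarith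
    then have "real a * \<mu> \<le> K / ((1 + \<epsilon>) * \<mu>) * \<mu>" using \<mu>(1) by (intro mult_right_mono) auto
    then show ?thesis using \<mu>(1) by simp
  qed
  \<comment> \<open>Rounding the time down lowers the expected total by at most \<mu>, hence by at
    most 1; \<open>Ke\<close> absorbs this loss at the end.\<close>
  have b: "real b * \<mu> \<le> (1 + \<epsilon>) * K" "(1 + \<epsilon>) * K - 1 \<le> real b * \<mu>"
  proof -
    have "0 \<le> (1 + \<epsilon>) * K / \<mu>" using \<mu>(1) K eps by (intro divide_nonneg_pos) auto
    then have "real b \<le> (1 + \<epsilon>) * K / \<mu>" "(1 + \<epsilon>) * K / \<mu> \<le> real b + 1"
      unfolding b_def by linarith+
    then have "real b * \<mu> \<le> (1 + \<epsilon>) * K" "(1 + \<epsilon>) * K \<le> (real b + 1) * \<mu>"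
      using \<mu>(1) by (simp_all only: pos_le_divide_eq pos_divide_le_eq)
    then show "real b * \<mu> \<le> (1 + \<epsilon>) * K" "(1 + \<epsilon>) * K - 1 \<le> real b * \<mu>"
      using \<mu>(2) by (simp_all add: distrib_right)
  qed
  let ?dev = "\<lambda>m d. {\<omega> \<in> space (draws (length L)). d \<le> \<bar>sample_sum L \<omega> m - m * \<mu>\<bar>}"
  \<comment> \<open>The bound is \<open>2 * K / (K * \<epsilon> / 2)\<^sup>2 = 8 / (K *
    \<epsilon>\<^sup>2)\<close>; the 64 in the hypothesis on \<open>K\<close> makes it 1/8.\<close>
  have dev: "prob (?dev m (K * \<epsilon> / 2)) \<le> 1 / 8" if "m * \<mu> \<le> 2 * K" for m
  proof -
    have "prob (?dev m (K * \<epsilon> / 2)) \<le> m * \<mu> / (K * \<epsilon> / 2)\<^sup>2"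
      unfolding \<mu>_def by (rule sample_sum_deviation) (use assms(1,2) Ke in auto)
    also have "\<dots> \<le> 2 * K / (K * \<epsilon> / 2)\<^sup>2"
      by (intro divide_right_mono that) auto
    also have "\<dots> = 8 / (K * \<epsilon>\<^sup>2)"
      using K by (simp add: power2_eq_square field_simps)
    also have "\<dots> \<le> 8 / 64"
      using Ke2 by (intro divide_left_mono) auto
    finally show ?thesis by simp
  qed
  have ms[measurable]: "(\<lambda>\<omega>. sample_sum L \<omega> m) \<in> borel_measurable (draws (length L))" for m
    unfolding sample_sum_def by measurable
  let ?A = "?dev a (K * \<epsilon> / 2)" and ?B = "?dev b (K * \<epsilon> / 2)"
  \<comment> \<open>The product \<open>(1 - \<epsilon> / 2) * (1 + \<epsilon>)\<close> exceeds 1 by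
    \<open>\<epsilon> * (1 - \<epsilon>) / 2\<close>, which is where \<epsilon> < 1 enters.\<close>
  have a_gap: "K / (1 + \<epsilon>) \<le> K - K * \<epsilon> / 2"
  proof -
    have "0 \<le> \<epsilon> * (1 - \<epsilon>)" using eps by simp
    then have "1 \<le> (1 - \<epsilon> / 2) * (1 + \<epsilon>)"
      by (simp add: algebra_simps)
    then have "K \<le> K * (1 - \<epsilon> / 2) * (1 + \<epsilon>)"
      using K mult_left_mono[of 1 "(1 - \<epsilon> / 2) * (1 + \<epsilon>)" K] by (simp add: mult.assoc)
    then have "K / (1 + \<epsilon>) \<le> K * (1 - \<epsilon> / 2)"
      using eps by (simp only: pos_divide_le_eq)
    then show ?thesis by (simp add: right_diff_distrib)
  qed
  have "(1 + \<epsilon>) * K \<le> 2 * K" using eps K by (intro mult_right_mono) auto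
  moreover have "K / (1 + \<epsilon>) \<le> 2 * K" using a_gap K Ke by linarith
  ultimately have "prob ?A \<le> 1 / 8" "prob ?B \<le> 1 / 8"
    using a b by (intro dev; linarith)+
  moreover have "prob (?A \<union> ?B) \<le> prob ?A + prob ?B"
    by (rule measure_Un_le) measurable
  ultimately have "prob (?A \<union> ?B) \<le> 1 / 4"
    by linarith
  moreover have "prob (space (draws (length L)) - (?A \<union> ?B)) = 1 - prob (?A \<union> ?B)"
    by (rule prob_compl) measurable
  moreover have "prob (space (draws (length L)) - (?A \<union> ?B)) \<le>
    \<P>(\<omega> in draws (length L). sample_sum L \<omega> a < K \<and> K \<le> sample_sum L \<omega> b)"
  proof (intro finite_measure_mono subsetI)
    fix \<omega> assume "\<omega> \<in> space (draws (length L)) - (?A \<union> ?B)"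
    then have "\<bar>sample_sum L \<omega> a - a * \<mu>\<bar> < K * \<epsilon> / 2" "\<bar>sample_sum L \<omega> b - b * \<mu>\<bar> < K * \<epsilon> / 2"
      by auto
    moreover have "(1 + \<epsilon>) * K = K + K * \<epsilon>" by (simp add: algebra_simps)
    ultimately have "sample_sum L \<omega> a < K" "K \<le> sample_sum L \<omega> b"
      using a b a_gap Ke unfolding abs_less_iff by linarith+
    then show "\<omega> \<in> {\<omega> \<in> space (draws (length L)). sample_sum L \<omega> a < K \<and> K \<le> sample_sum L \<omega> b}"
      by simp
  qed measurable
  ultimately show ?thesis unfolding a_def b_def by linarith
qed

subsection \<open>Executions of the machine\<close>

lemma run_0: "run P L \<omega> 0 = init L"
  by (simp add: run_def)

lemma run_Suc: "run P L \<omega> (Suc t) = step P L \<omega> (run P L \<omega> t)"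
  by (simp add: run_def)

lemma run_add: "run P L \<omega> (k + t) = (step P L \<omega> ^^ k) (run P L \<omega> t)"
  by (simp add: run_def funpow_add)

lemma halted_run_mono:
  assumes "halted P (run P L \<omega> t)" "t \<le> u"
  shows "run P L \<omega> u = run P L \<omega> t"
  using assms(2)
proof (induction u rule: dec_induct)
  case (step u)
  with assms(1) show ?case by (simp add: run_Suc step_def halted_def)
qed simp

text \<open>A halted configuration is a fixed point of \<open>step\<close>, so the output can be
  read off at any halted time; the least one need not be known.\<close>

lemma halted_runD:
  assumes "halted P (run P L \<omega> t)"
  shows "halts P L \<omega>" "run_time P L \<omega> \<le> t" "result P L \<omega> = mem (run P L \<omega> t) 0"
proof -
  show "halts P L \<omega>" using assms by (auto simp: halts_def)
  show le: "run_time P L \<omega> \<le> t" unfolding run_time_def using assms by (rule Least_le)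
  have "halted P (run P L \<omega> (run_time P L \<omega>))"
    unfolding run_time_def using assms by (rule LeastI)
  from halted_run_mono[OF this le] show "result P L \<omega> = mem (run P L \<omega> t) 0"
    by (simp add: result_def)
qed

section \<open>Dependence of a run on a finite prefix of the tape, and measurability\<close>

lemma used_step: "used (step P L \<omega> c) \<le> Suc (used c)"
  by (cases "P ! pc c") (auto simp: step_def set_mem_def Let_def)

lemma used_run: "used (run P L \<omega> t) \<le> t"
proof (induction t)
  case (Suc t)
  then show ?case using used_step[of P L \<omega> "run P L \<omega> t"] by (simp add: run_Suc)
qed (simp add: run_0 init_def)

text \<open>The step made at time t consults only the tape entry with index \<open>used\<close>,
  which is at most t because each step consumes at most one entry.\<close>

lemma run_cong:
  assumes "\<And>k. k < t \<Longrightarrow> \<omega> k = \<omega>' k"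
  shows "run P L \<omega> t = run P L \<omega>' t"
  using assms
proof (induction t)
  case (Suc t)
  have "exec L \<omega> I c = exec L \<omega>' I c" if "\<omega> (used c) = \<omega>' (used c)" for I c
    using that by (cases I) auto
  moreover have "\<omega> (used (run P L \<omega> t)) = \<omega>' (used (run P L \<omega> t))"
    using Suc.prems used_run[of P L \<omega> t] by simp
  ultimately show ?case using Suc by (simp add: run_Suc step_def)
qed (simp add: run_0)

text \<open>Coding a prefix as a list, a countable type, makes it measurable into a discrete space;
  every predicate of the prefix is then measurable.\<close>

lemma measurable_draws_prefix:
  "(\<lambda>\<omega>. map \<omega> [0..<t]) \<in> draws n \<rightarrow>\<^sub>M count_space UNIV"
proof (induction t)
  case (Suc t)
  note [measurable] = Suc
  have "(\<lambda>\<omega>. map \<omega> [0..<t] @ [\<omega> t]) \<in> draws n \<rightarrow>\<^sub>M count_space UNIV"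
    by measurable
  then show ?case by simp
qed simp

lemma measurable_run [measurable]:
  "Measurable.pred (draws n) (\<lambda>\<omega>. Q (run P L \<omega> t))"
proof -
  \<comment> \<open>Past its end the list has unspecified values, but t steps never look that
    far.\<close>
  have "run P L \<omega> t = run P L (\<lambda>k. map \<omega> [0..<t] ! k) t" for \<omega>
    by (rule run_cong) simp
  then have "(\<lambda>\<omega>. Q (run P L \<omega> t)) = (\<lambda>xs. Q (run P L (\<lambda>k. xs ! k) t)) \<circ> (\<lambda>\<omega>. map \<omega> [0..<t])"
    by auto
  also have "\<dots> \<in> draws n \<rightarrow>\<^sub>M count_space UNIV"
    by (rule measurable_comp[OF measurable_draws_prefix]) simp
  finally show ?thesis .
qed

text \<open>The predicate \<open>R\<close> may be arbitrary because a run of \<open>t\<close> steps sees only a prefix of the tape.\<close>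

lemma measurable_halts_result:
  "Measurable.pred (draws n) (\<lambda>\<omega>. halts P L \<omega> \<and> R (result P L \<omega>) (run_time P L \<omega>))"
proof -
  \<comment> \<open>Splitting by the value t of the least halting time turns the event into a
    countable union of events about runs of bounded length.\<close>
  have "halts P L \<omega> \<and> R (result P L \<omega>) (run_time P L \<omega>) \<longleftrightarrow>
    (\<exists>t. halted P (run P L \<omega> t) \<and> R (mem (run P L \<omega> t) 0) t \<and> (\<forall>u<t. \<not> halted P (run P L \<omega> u)))" for \<omega>
  proof
    assume "halts P L \<omega> \<and> R (result P L \<omega>) (run_time P L \<omega>)"
    then show "\<exists>t. halted P (run P L \<omega> t) \<and> R (mem (run P L \<omega> t) 0) t \<and> (\<forall>u<t. \<not> halted P (run P L \<omega> u))"
      unfolding halts_def result_def run_time_def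
      by (intro exI[of _ "LEAST t. halted P (run P L \<omega> t)"]) (auto intro: LeastI dest: not_less_Least)
  next
    assume "\<exists>t. halted P (run P L \<omega> t) \<and> R (mem (run P L \<omega> t) 0) t \<and> (\<forall>u<t. \<not> halted P (run P L \<omega> u))"
    then obtain t where t: "halted P (run P L \<omega> t)" "R (mem (run P L \<omega> t) 0) t"
      "\<And>u. u < t \<Longrightarrow> \<not> halted P (run P L \<omega> u)" by blast
    then have "run_time P L \<omega> = t"
      unfolding run_time_def by (intro Least_equality) (auto simp: not_less[symmetric])
    with t halted_runD[OF t(1)] show "halts P L \<omega> \<and> R (result P L \<omega>) (run_time P L \<omega>)" by simp
  qed
  then show ?thesis by simp
qed

subsection \<open>The stopping rule as a program\<close>

text \<open>
  Cell 0 holds \<open>n\<close>, cell 1 the threshold, cell 2 the number of draws, cell 3 the running total,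
  cell 4 the constant 1, cells 5 and 6 the last draw; cell 7 stays 0. The exact summation
  (positions 10 to 16) counts cell 2 down from \<open>n\<close>.
\<close>

definition stopping_prog :: "nat \<Rightarrow> prog" where
  "stopping_prog K = [
     Const 1 (of_nat K), Const 4 1,
     Draw 5 6, Add 3 3 6, Add 2 2 4, JumpLess 3 1 9,
     Mul 0 0 1, Div 0 0 2, Halt,
     JumpLess 2 0 2,
     Const 3 0,
     Read 6 2, Add 3 3 6, Sub 2 2 4, JumpLess 7 2 11,
     Copy 0 3, Halt]"

text \<open>Invariant at the head of the sampling loop. Cell 7 is carried along for the later
  comparison with 0.\<close>

definition sampling :: "nat \<Rightarrow> real list \<Rightarrow> (nat \<Rightarrow> nat) \<Rightarrow> nat \<Rightarrow> config \<Rightarrow> bool" where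
  "sampling K L \<omega> m c \<longleftrightarrow> pc c = 2 \<and> used c = m \<and> mem c 0 = length L \<and> mem c 1 = K \<and>
     mem c 2 = m \<and> mem c 3 = sample_sum L \<omega> m \<and> mem c 4 = 1 \<and> mem c 7 = 0"

text \<open>Invariant of the summing loop, with the last \<open>m\<close> items already added. Going
  backwards allows cell 2, which equals the length of the list on entry, to serve as the position to
  read next.\<close>

definition summing :: "real list \<Rightarrow> nat \<Rightarrow> config \<Rightarrow> bool" where
  "summing L m c \<longleftrightarrow> pc c = 11 \<and> mem c 2 = length L - m \<and>
     mem c 3 = sum_list (drop (length L - m) L) \<and> mem c 4 = 1 \<and> mem c 7 = 0"

section \<open>Effect of single rounds of the program\<close>

lemma funpow_unfold:
  "(f ^^ 2) x = f (f x)" "(f ^^ 4) x = f (f (f (f x)))" "(f ^^ 5) x = f (f (f (f (f x))))"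
  "(f ^^ 6) x = f (f (f (f (f (f x)))))"
  by (simp_all add: eval_nat_numeral)

lemma stopping_prog_init:
  "sampling K L \<omega> 0 (run (stopping_prog K) L \<omega> (Suc (Suc 0)))"
  by (simp add: run_def funpow_unfold step_def stopping_prog_def set_mem_def init_def sampling_def sample_sum_def)

lemma stopping_prog_continue:
  assumes "sampling K L \<omega> m c" "sample_sum L \<omega> (Suc m) < K" "Suc m < length L"
  shows "sampling K L \<omega> (Suc m) ((step (stopping_prog K) L \<omega> ^^ 5) c)"
  using assms
  by (simp add: funpow_unfold step_def stopping_prog_def set_mem_def Let_def sampling_def sample_sum_def add.commute)

text \<open>The threshold test precedes the test of the count, so a total that reaches
  \<open>K\<close> only at the last permitted draw still gives the quotient.\<close>

lemma stopping_prog_quotient: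
  assumes "sampling K L \<omega> m c" "K \<le> sample_sum L \<omega> (Suc m)"
  shows "halted (stopping_prog K) ((step (stopping_prog K) L \<omega> ^^ 6) c)"
    "mem ((step (stopping_prog K) L \<omega> ^^ 6) c) 0 = length L * K / Suc m"
  using assms
  by (simp_all add: funpow_unfold step_def stopping_prog_def set_mem_def Let_def sampling_def sample_sum_def halted_def)

lemma stopping_prog_exact:
  assumes "sampling K L \<omega> m c" "sample_sum L \<omega> (Suc m) < K" "length L = Suc m"
  shows "summing L 0 ((step (stopping_prog K) L \<omega> ^^ 6) c)"
  using assms
  by (simp add: funpow_unfold step_def stopping_prog_def set_mem_def Let_def sampling_def summing_def sample_sum_def)

lemma stopping_prog_read:
  assumes "summing L m c" "m < length L"
  shows "let c' = (step (stopping_prog K) L \<omega> ^^ 4) c in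
    if Suc m < length L then summing L (Suc m) c' else pc c' = 15 \<and> mem c' 3 = sum_list L"
proof -
  \<comment> \<open>The position read in this round, counted from 1; the last round is the one with
    \<open>i = 1\<close>.\<close>
  define i where "i = length L - m"
  have i: "real (length L) - real m = real i" "i \<in> {1..length L}" "length L - Suc m = i - 1"
    "Suc m < length L \<longleftrightarrow> 1 < i" using assms by (auto simp: i_def)
  have "drop (i - 1) L = L ! (i - 1) # drop i L"
    using i by (metis Cons_nth_drop_Suc Suc_diff_1 Suc_le_lessD atLeastAtMost_iff less_eq_Suc_le One_nat_def diff_less less_le_trans zero_less_one)
  then have s: "sum_list (drop (i - Suc 0) L) = sum_list (drop i L) + L ! (i - Suc 0)" by simp
  have "real i \<in> real ` {Suc 0..length L}" using i by auto
  moreover have "sum_list (drop i L) + L ! (i - Suc 0) = sum_list L" if "\<not> 1 < i"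
    using s that i by (cases i) auto
  ultimately show ?thesis
    using assms(1) i s
    by (auto simp: funpow_unfold step_def stopping_prog_def set_mem_def Let_def summing_def of_nat_diff
      simp flip: i_def)
qed

lemma stopping_prog_output:
  assumes "pc c = 15"
  shows "halted (stopping_prog K) (step (stopping_prog K) L \<omega> c)"
    "mem (step (stopping_prog K) L \<omega> c) 0 = mem c 3"
  using assms by (simp_all add: halted_def step_def stopping_prog_def set_mem_def)

text \<open>The time is 2 steps of initialisation, 5 for each of the \<open>m - 1\<close> rounds
  that continue, and 6 for the last round with the quotient.\<close>

lemma stopping_prog_stops:
  assumes "0 < m" "m \<le> length L" "K \<le> sample_sum L \<omega> m" "\<And>j. j < m \<Longrightarrow> sample_sum L \<omega> j < K"
  shows "halts (stopping_prog K) L \<omega>"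
    "run_time (stopping_prog K) L \<omega> \<le> 5 * m + 3"
    "result (stopping_prog K) L \<omega> = length L * K / m"
proof -
  have inv: "j < m \<Longrightarrow> sampling K L \<omega> j (run (stopping_prog K) L \<omega> (5 * j + 2))" for j
  proof (induction j)
    case (Suc j)
    then show ?case
      using assms stopping_prog_continue[of K L \<omega> j "run (stopping_prog K) L \<omega> (5 * j + 2)"]
      by (simp flip: run_add)
  qed (use stopping_prog_init in simp)
  obtain j where j: "m = Suc j" using assms(1) by (cases m) auto
  from stopping_prog_quotient[OF inv[of j]] assms j
  have "halted (stopping_prog K) (run (stopping_prog K) L \<omega> (5 * m + 3))"
    "mem (run (stopping_prog K) L \<omega> (5 * m + 3)) 0 = length L * K / m"
    by (simp_all flip: run_add)
  with halted_runD[OF this(1)]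
  show "halts (stopping_prog K) L \<omega>"
    "run_time (stopping_prog K) L \<omega> \<le> 5 * m + 3"
    "result (stopping_prog K) L \<omega> = length L * K / m" by simp_all
qed

text \<open>Sampling and the switch to summation take \<open>5 * n + 3\<close> steps for a list of
  length \<open>n\<close>, the backward pass 4 per item, and copying the output 1.\<close>

lemma stopping_prog_sums:
  assumes "L \<noteq> []" "\<And>j. j \<le> length L \<Longrightarrow> sample_sum L \<omega> j < K"
  shows "halts (stopping_prog K) L \<omega>"
    "run_time (stopping_prog K) L \<omega> \<le> 9 * length L + 4"
    "result (stopping_prog K) L \<omega> = sum_list L"
proof -
  let ?run = "run (stopping_prog K) L \<omega>" and ?n = "length L"
  have inv: "j < ?n \<Longrightarrow> sampling K L \<omega> j (?run (5 * j + 2))" for j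
  proof (induction j)
    case (Suc j)
    then show ?case
      using assms stopping_prog_continue[of K L \<omega> j "?run (5 * j + 2)"]
      by (simp flip: run_add)
  qed (use stopping_prog_init in simp)
  obtain l where l: "?n = Suc l" using assms(1) by (cases L) auto
  have "summing L 0 (?run (5 * ?n + 3))"
    using stopping_prog_exact[OF inv[of l]] l assms by (simp flip: run_add)
  moreover have "5 * ?n + 3 + 4 * Suc j = 4 + (5 * ?n + 3 + 4 * j)" for j by simp
  ultimately have inv2: "j < ?n \<Longrightarrow> summing L j (?run (5 * ?n + 3 + 4 * j))" for j
  proof (induction j)
    case (Suc j)
    then show ?case
      using stopping_prog_read[of L j "?run (5 * ?n + 3 + 4 * j)" K \<omega>]
      by (simp add: Let_def flip: run_add)
  qed simp
  have "pc (?run (9 * ?n + 3)) = 15" "mem (?run (9 * ?n + 3)) 3 = sum_list L"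
    using stopping_prog_read[OF inv2[of l], of K \<omega>] l
    by (simp_all add: Let_def flip: run_add)
  moreover have "?run (9 * ?n + 4) = step (stopping_prog K) L \<omega> (?run (9 * ?n + 3))"
    unfolding run_Suc[symmetric] by (simp only: Suc_eq_plus1 add.assoc one_plus_numeral numeral_plus_one Num.arith_simps)
  ultimately have "halted (stopping_prog K) (?run (9 * ?n + 4))" "mem (?run (9 * ?n + 4)) 0 = sum_list L"
    using stopping_prog_output by simp_all
  with halted_runD[OF this(1)] show "halts (stopping_prog K) L \<omega>"
    "run_time (stopping_prog K) L \<omega> \<le> 9 * length L + 4"
    "result (stopping_prog K) L \<omega> = sum_list L" by simp_all
qed

section \<open>From the stopping time to accuracy and running time\<close>

lemma sample_sum_mono:
  assumes "set L \<subseteq> {0..1}" "\<forall>k. \<omega> k \<in> {1..length L}" "i \<le> j"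
  shows "sample_sum L \<omega> i \<le> sample_sum L \<omega> j"
proof -
  have "0 \<le> L ! (\<omega> k - 1)" for k
  proof -
    have "L ! (\<omega> k - 1) \<in> set L" using assms(2)[rule_format, of k] by (intro nth_mem) auto
    then show ?thesis using assms(1) by auto
  qed
  then show ?thesis
    unfolding sample_sum_def using assms(3) by (intro sum_mono2) auto
qed

text \<open>The deterministic half of the argument: on a legal tape, \<open>lower\<close> and
  \<open>upper\<close> confine the stopping time \<open>m\<close>. Its lower bound yields the upper
  bound on \<open>n * K / m\<close>, and conversely.\<close>

lemma stopping_prog_correct:
  assumes L: "L \<noteq> []" "set L \<subseteq> {0..1}" "0 < sum_list L"
    and "0 < \<epsilon>" "\<epsilon> < 1" "0 < K" and \<omega>: "\<forall>k. \<omega> k \<in> {1..length L}"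
  defines "\<mu> \<equiv> sum_list L / length L"
  assumes lower: "sample_sum L \<omega> (nat \<lfloor>K / ((1 + \<epsilon>) * \<mu>)\<rfloor>) < K"
    and upper: "K \<le> sample_sum L \<omega> (nat \<lfloor>(1 + \<epsilon>) * K / \<mu>\<rfloor>)"
  shows "halts (stopping_prog K) L \<omega>"
    "approximates \<epsilon> (sum_list L) (result (stopping_prog K) L \<omega>)"
    "run_time (stopping_prog K) L \<omega> \<le> 26 * real K * (length L / sum_list L)"
proof -
  let ?S = "sum_list L" and ?n = "length L"
  define b where "b = nat \<lfloor>(1 + \<epsilon>) * K / \<mu>\<rfloor>"
  have n: "?n > 0" using L by simp
  have \<mu>: "\<mu> > 0" using L by (simp add: \<mu>_def)
  have b: "real b \<le> (1 + \<epsilon>) * K * (?n / ?S)"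
  proof -
    have "real b \<le> (1 + \<epsilon>) * K / \<mu>" unfolding b_def using \<mu> \<open>0 < \<epsilon>\<close> by simp
    then show ?thesis by (simp add: \<mu>_def)
  qed
  also have "\<dots> \<le> 2 * K * (?n / ?S)"
    using \<open>0 < \<epsilon>\<close> \<open>\<epsilon> < 1\<close> \<open>0 < K\<close> L(3) by (intro mult_right_mono) auto
  finally have b2: "real b \<le> 2 * K * (?n / ?S)" .
  have "halts (stopping_prog K) L \<omega> \<and>
    approximates \<epsilon> ?S (result (stopping_prog K) L \<omega>) \<and>
    run_time (stopping_prog K) L \<omega> \<le> 26 * real K * (?n / ?S)"
  proof (cases "\<exists>m\<le>?n. K \<le> sample_sum L \<omega> m")
    case True
    define m where "m = (LEAST m. K \<le> sample_sum L \<omega> m)"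
    have m: "K \<le> sample_sum L \<omega> m" unfolding m_def using True by (metis LeastI)
    have less: "sample_sum L \<omega> j < K" if "j < m" for j
      using not_less_Least[of j "\<lambda>m. K \<le> sample_sum L \<omega> m"] that by (simp add: m_def)
    have "m \<le> ?n" using True less by (meson le_trans not_le)
    have "m > 0" using m \<open>0 < K\<close> by (cases m) (auto simp: sample_sum_def)
    have "m \<le> b" using upper less[of b] by (auto simp: b_def not_le[symmetric])
    \<comment> \<open>An integer above the rounded-down time is above the time itself, so rounding
      costs no accuracy.\<close>
    have "\<not> m \<le> nat \<lfloor>K / ((1 + \<epsilon>) * \<mu>)\<rfloor>"
      using sample_sum_mono[OF L(2) \<omega>] m lower by fastforce
    then have "K / ((1 + \<epsilon>) * \<mu>) \<le> m"
      by linarith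
    then have "K \<le> m * ((1 + \<epsilon>) * \<mu>)"
      using \<mu> \<open>0 < \<epsilon>\<close> by (simp add: pos_divide_le_eq)
    then have up: "?n * K / m \<le> (1 + \<epsilon>) * ?S"
      using n \<open>m > 0\<close> by (simp add: \<mu>_def field_simps)
    have "real m \<le> (1 + \<epsilon>) * K * (?n / ?S)"
      using b \<open>m \<le> b\<close> by linarith
    then have "?S / (1 + \<epsilon>) \<le> ?n * K / m"
      using n L(3) \<open>m > 0\<close> \<open>0 < \<epsilon>\<close> by (simp add: field_simps)
    moreover have "real (5 * m + 3) \<le> 26 * real K * (?n / ?S)"
      using b2 \<open>m \<le> b\<close> \<open>m > 0\<close> by linarith
    ultimately show ?thesis
      using stopping_prog_stops[OF \<open>m > 0\<close> \<open>m \<le> ?n\<close> m less] up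
      by (simp add: approximates_def)
  next
    case False
    then have "sample_sum L \<omega> ?n < sample_sum L \<omega> b" using upper by (force simp: b_def)
    then have "?n < b" using sample_sum_mono[OF L(2) \<omega>, of b ?n] by force
    \<comment> \<open>Source of the 26: \<open>9 * n + 4\<close> is at most \<open>13 * n\<close>,
      and \<open>n\<close> is below \<open>b\<close>, hence below \<open>2 * K * (n / S)\<close>.
      The other case needs only 16, from \<open>5 * m + 3 \<le> 8 * m\<close>.\<close>
    then have time: "real (9 * ?n + 4) \<le> 26 * real K * (?n / ?S)"
      using b2 n by linarith
    have "sample_sum L \<omega> j < K" if "j \<le> ?n" for j
      using False that by (meson not_le)
    note sums = stopping_prog_sums[OF L(1) this]
    have "real (run_time (stopping_prog K) L \<omega>) \<le> real (9 * ?n + 4)"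
      using sums(2) by (rule of_nat_mono)
    moreover have "approximates \<epsilon> ?S ?S"
      using L(3) \<open>0 < \<epsilon>\<close> by (simp add: approximates_def field_simps)
    ultimately show ?thesis
      using sums time by simp
  qed
  then show "halts (stopping_prog K) L \<omega>"
    "approximates \<epsilon> ?S (result (stopping_prog K) L \<omega>)"
    "run_time (stopping_prog K) L \<omega> \<le> 26 * real K * (?n / ?S)" by auto
qed

text \<open>For sum 0 the only admissible output is 0. The totals never reach \<open>K\<close>, and
  the exact summation is what makes the program halt.\<close>

lemma stopping_prog_zero:
  assumes L: "L \<noteq> []" "set L \<subseteq> {0..1}" "sum_list L = 0" and "0 < K"
    and \<omega>: "\<forall>k. \<omega> k \<in> {1..length L}"
  shows "halts (stopping_prog K) L \<omega>" "result (stopping_prog K) L \<omega> = 0"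
proof -
  have zero: "\<forall>x\<in>set L. x = 0"
    using L(2,3) by (subst (asm) sum_list_nonneg_eq_0_iff) auto
  have "L ! (\<omega> k - 1) = 0" for k
  proof -
    have "L ! (\<omega> k - 1) \<in> set L" using \<omega>[rule_format, of k] by (intro nth_mem) auto
    then show ?thesis using zero by blast
  qed
  then have "sample_sum L \<omega> j < K" for j
    using \<open>0 < K\<close> by (simp add: sample_sum_def)
  from stopping_prog_sums[OF L(1) this] L(3)
  show "halts (stopping_prog K) L \<omega>" "result (stopping_prog K) L \<omega> = 0" by auto
qed

theorem theorem4:
  fixes \<epsilon> :: real
  assumes "0 < \<epsilon>" and "\<epsilon> < 1"
  shows "\<exists>P :: prog. \<exists>C > 0. \<exists>N :: nat. \<forall>L :: real list.
           L \<noteq> [] \<longrightarrow> set L \<subseteq> {0..1} \<longrightarrow>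
           \<P>(\<omega> in draws (length L).
              halts P L \<omega> \<and>
              approximates \<epsilon> (sum_list L) (result P L \<omega>) \<and>
              (length L \<ge> N \<longrightarrow> sum_list L > 0 \<longrightarrow>
                 real (run_time P L \<omega>) \<le>
                   C * (real (length L) * log 2 (log 2 (real (length L))) / sum_list L)))
           \<ge> 3 / 4"
proof -
  \<comment> \<open>A natural number, since constants of a program must be rational; it is chosen
    from \<epsilon> alone.\<close>
  obtain K :: nat where K: "64 / \<epsilon>\<^sup>2 \<le> K" using real_arch_simple by blast
  then have "0 < K" using assms by (cases K) (auto simp: divide_le_0_iff)
  let ?P = "stopping_prog K"
  have "3 / 4 \<le> \<P>(\<omega> in draws (length L). halts ?P L \<omega> \<and>
      approximates \<epsilon> (sum_list L) (result ?P L \<omega>) \<and>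
      (length L \<ge> 4 \<longrightarrow> sum_list L > 0 \<longrightarrow> real (run_time ?P L \<omega>) \<le>
         26 * real K * (real (length L) * log 2 (log 2 (real (length L))) / sum_list L)))"
    (is "_ \<le> \<P>(\<omega> in _. ?good L \<omega>)")
    if L: "L \<noteq> []" "set L \<subseteq> {0..1}" for L
  proof -
    interpret prob_space "draws (length L)" by (rule prob_space_draws)
    \<comment> \<open>Needed for a lower bound, as a set that is not an event has measure 0 by
      convention.\<close>
    have good: "{\<omega> \<in> space (draws (length L)). ?good L \<omega>} \<in> events"
      using measurable_halts_result[where P = ?P and L = L and n = "length L" and R =
          "\<lambda>s t. approximates \<epsilon> (sum_list L) s \<and> (length L \<ge> 4 \<longrightarrow> sum_list L > 0 \<longrightarrow> real t \<le>
             26 * real K * (real (length L) * log 2 (log 2 (real (length L))) / sum_list L))"]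
      by (rule predE)
    have valid: "AE \<omega> in draws (length L). \<forall>k. \<omega> k \<in> {1..length L}"
      using L by (intro AE_draws) simp
    have "0 \<le> sum_list L" using L by (intro sum_list_nonneg) auto
    then consider "sum_list L = 0" | "0 < sum_list L" by linarith
    then show ?thesis
    proof cases
      case 1
      have "AE \<omega> in draws (length L). ?good L \<omega>"
        using valid by eventually_elim
          (use stopping_prog_zero[OF L 1 \<open>0 < K\<close>] 1 in \<open>auto simp: approximates_def\<close>)
      then show ?thesis using prob_Collect_eq_1[OF good] by simp
    next
      case 2
      \<comment> \<open>From length 4 on the iterated logarithm is at least 1, so the bound without
        it implies the stated one; this gives the witness 4 for \<open>N\<close>.\<close>
      have loglog: "real (length L) / sum_list L \<le>
          real (length L) * log 2 (log 2 (real (length L))) / sum_list L" if "4 \<le> length L"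
      proof -
        have "2 \<le> log 2 (real (length L))"
          using that by (subst le_log_iff) auto
        then have "1 \<le> log 2 (log 2 (real (length L)))"
          by (subst le_log_iff) auto
        then show ?thesis
          using 2 mult_left_mono[of 1 _ "real (length L)"] by (intro divide_right_mono) auto
      qed
      have time: "run_time ?P L \<omega> \<le> 26 * real K * (real (length L) * log 2 (log 2 (real (length L))) / sum_list L)"
        if "run_time ?P L \<omega> \<le> 26 * real K * (length L / sum_list L)" "4 \<le> length L" for \<omega>
        using that(1) mult_left_mono[OF loglog[OF that(2)], of "26 * K"] by simp
      have "AE \<omega> in draws (length L).
          sample_sum L \<omega> (nat \<lfloor>K / ((1 + \<epsilon>) * (sum_list L / length L))\<rfloor>) < K \<and>
          K \<le> sample_sum L \<omega> (nat \<lfloor>(1 + \<epsilon>) * K / (sum_list L / length L)\<rfloor>) \<longrightarrow> ?good L \<omega>"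
        using valid
      proof eventually_elim
        case (elim \<omega>)
        show ?case
        proof (rule impI, elim conjE)
          assume "sample_sum L \<omega> (nat \<lfloor>K / ((1 + \<epsilon>) * (sum_list L / length L))\<rfloor>) < K"
            and "K \<le> sample_sum L \<omega> (nat \<lfloor>(1 + \<epsilon>) * K / (sum_list L / length L)\<rfloor>)"
          note correct = stopping_prog_correct[OF L 2 assms \<open>0 < K\<close> elim this]
          show "?good L \<omega>"
            by (intro conjI impI correct(1,2) time correct(3))
        qed
      qed
      then have "\<P>(\<omega> in draws (length L).
          sample_sum L \<omega> (nat \<lfloor>K / ((1 + \<epsilon>) * (sum_list L / length L))\<rfloor>) < K \<and>
          K \<le> sample_sum L \<omega> (nat \<lfloor>(1 + \<epsilon>) * K / (sum_list L / length L)\<rfloor>)) \<le>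
          \<P>(\<omega> in draws (length L). ?good L \<omega>)"
        using good by (intro finite_measure_mono_AE) auto
      with sample_sum_concentration[OF L 2 assms K] show ?thesis by linarith
    qed
  qed
  then show ?thesis
    using \<open>0 < K\<close> by (intro exI[of _ ?P] exI[of _ "26 * real K"] exI[of _ "4::nat"]) auto
qed

end
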